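(* Let $a_1,\dots,a_n>0$ be task lengths and let the disruption intensity be $\lambda(t)=\bar\lambda f(t)$ with $\bar\lambda>0$ and $f$ a positive differentiable function on $[0,\infty)$ with $0<\inf f\le\sup f<\infty$. Assume there exists $t_0>0$ such that $\lambda(t)=\lambda(t_0)$ for all $t>t_0$. If $a_i>t_0$ for every $1\le i\le n$, then $M_{1:n}(0)=M_{\pi(1):\pi(n)}(0)$ for every permutation $\pi$ of $\{1,\dots,n\}$.
   Context: Model: a single machine processes a finite batch of tasks one at a time in a fixed order. A task of length $c>0$ requires $c$ units of uninterrupted processing. Disruptions occur at the points of a non-homogeneous Poisson process on $[0,\infty)$ with intensity function $\lambda(t)$. If a disruption occurs while a task is being processed, all work on it is lost and that task is restarted from scratch at the disruption time (no repair time); a task is completed once it has been processed for $c$ consecutive time units with no disruption, and the machine then immediately starts the next task. For a permutation $\pi$ of $\{1,\dots,n\}$, $M_{\pi(1):\pi(n)}(t)$ denotes the expected time, measured from $t$, to complete all tasks in the order $a_{\pi(1)},\dots,a_{\pi(n)}$ when processing of $a_{\pi(1)}$ starts at time $t$; $M_{1:n}$ corresponds to the order $a_1,\dots,a_n$. *)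

theory Defs
  imports "HOL-Probability.Probability"
begin

text \<open>Deterministic dynamics. Given the set D of disruption times, a task of
length c whose processing starts at time t is completed at
  min { s + c | s in {t} union (D intersected with [t,oo)), no disruption in (s, s+c) },
i.e. the first (re)start time s after which the machine runs c time units
without disruption.\<close>

definition task_finish :: "real set \<Rightarrow> real \<Rightarrow> real \<Rightarrow> real" where
  "task_finish D c t =
     Inf {s + c | s. s \<in> insert t D \<and> t \<le> s \<and> D \<inter> {s<..<s + c} = {}}"

fun seq_finish :: "real set \<Rightarrow> real list \<Rightarrow> real \<Rightarrow> real" where
  "seq_finish D [] t = t"
| "seq_finish D (c # cs) t = seq_finish D cs (task_finish D c t)"

definition interval_count :: "('w \<Rightarrow> real set) \<Rightarrow> real \<Rightarrow> real \<Rightarrow> 'w \<Rightarrow> nat" where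
  "interval_count D a b \<omega> = card (D \<omega> \<inter> {a<..b})"

definition nhpp :: "'w measure \<Rightarrow> (real \<Rightarrow> real) \<Rightarrow> ('w \<Rightarrow> real set) \<Rightarrow> bool" where
  "nhpp P lam D \<longleftrightarrow>
     prob_space P \<and>
     (\<forall>\<omega>\<in>space P. D \<omega> \<subseteq> {0..} \<and> (\<forall>b. finite (D \<omega> \<inter> {..b}))) \<and>
     (\<forall>a b. 0 \<le> a \<longrightarrow> a \<le> b \<longrightarrow>
        interval_count D a b \<in> measurable P (count_space UNIV) \<and>
        (\<forall>k. measure P {\<omega> \<in> space P. interval_count D a b \<omega> = k}
              = (integral {a..b} lam) ^ k / fact k * exp (- integral {a..b} lam))) \<and>
     (\<forall>(I :: nat \<Rightarrow> real \<times> real) k.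
        (\<forall>i<k. 0 \<le> fst (I i) \<and> fst (I i) \<le> snd (I i)) \<longrightarrow>
        disjoint_family_on (\<lambda>i. {fst (I i)<..snd (I i)}) {..<k} \<longrightarrow>
        prob_space.indep_vars P (\<lambda>_. count_space UNIV)
          (\<lambda>i. interval_count D (fst (I i)) (snd (I i))) {..<k})"

definition expected_makespan :: "'w measure \<Rightarrow> ('w \<Rightarrow> real set) \<Rightarrow> real list \<Rightarrow> real \<Rightarrow> ennreal" where
  "expected_makespan P D cs t = (\<integral>\<^sup>+ \<omega>. ennreal (seq_finish (D \<omega>) cs t - t) \<partial>P)"

end

theory Submission
  imports Defs
begin

text \<open>
  Divide time into cells of length \<open>h = t0 / N\<close> and call a cell empty if it contains no
  disruption. A task of length \<open>c\<close> is finished at the first time \<open>u \<ge> t + c\<close> with no disruption in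
  \<open>(u - c, u)\<close>, so up to an error \<open>h\<close> the makespan lies between the times at which a discrete chain
  has seen the required runs of empty cells, when the run lengths \<open>c / h\<close> are rounded down or up.
  Cells are independent, and after \<open>t0\<close> each is empty with the same probability \<open>q\<close>. Once \<open>t0\<close> is
  passed, a function of the chain built from the terms \<open>q\<close> to the power \<open>- m\<close>, for the missing run
  lengths \<open>m\<close>, drops on average by \<open>1 - q\<close> per cell until all runs are seen. As every
  task is longer than \<open>t0\<close>, at \<open>t0\<close> the chain is still in its first run, and the number of empty
  cells just seen does not depend on the tasks. Hence the mean of the discrete makespan is explicit
  and symmetric in the run lengths. Letting \<open>h\<close> tend to 0 closes the gap between the two bounds.
\<close>

section \<open>Completion times and the discrete chain\<close>

text \<open>A state holds the run lengths still missing and the number of empty cells counted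
  towards the first of them; \<open>b\<close> means that the cell contains a disruption. The final
  state has counter 0, so that its potential vanishes.\<close>

fun grid_step :: "bool \<Rightarrow> nat list \<times> nat \<Rightarrow> nat list \<times> nat" where
  "grid_step b ([], a) = ([], 0)"
| "grid_step b (m # ms, a) =
     (if b then (m # ms, 0) else if Suc a = m then (ms, 0) else (m # ms, Suc a))"

fun grid_state :: "(nat \<Rightarrow> bool) \<Rightarrow> nat list \<Rightarrow> nat \<Rightarrow> nat list \<times> nat" where
  "grid_state B ms 0 = (ms, 0)"
| "grid_state B ms (Suc k) = grid_step (B k) (grid_state B ms k)"

definition completion_times :: "real set \<Rightarrow> real \<Rightarrow> real \<Rightarrow> real set" where
  "completion_times D c t = {u. t + c \<le> u \<and> D \<inter> {u - c<..<u} = {}}"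

lemma completion_times_bdd_below: "bdd_below (completion_times D c t)"
  by (rule bdd_belowI[of _ "t + c"]) (simp add: completion_times_def)

text \<open>Moving a disruption-free interval \<open>(u - c, u)\<close> back to the last restart
  time not after \<open>u - c\<close> keeps it free of disruptions, so each completion time has a
  member of the smaller set at or below it. Completion times need not begin at a restart, which
  makes them easy to exhibit on a grid.\<close>

lemma task_finish_eq_Inf:
  assumes fin: "\<And>b. finite (D \<inter> {..b})" and c: "c > 0"
  shows "task_finish D c t = Inf (completion_times D c t)"
proof -
  let ?A = "{s + c | s. s \<in> insert t D \<and> t \<le> s \<and> D \<inter> {s<..<s + c} = {}}"
  let ?F = "completion_times D c t"
  have sub: "?A \<subseteq> ?F"
    by (auto simp: completion_times_def)
  have ex: "\<exists>v\<in>?A. v \<le> u" if u: "u \<in> ?F" for u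
  proof -
    let ?S = "insert t D \<inter> {t..u - c}"
    have tu: "t + c \<le> u" and emp: "D \<inter> {u - c<..<u} = {}"
      using u by (auto simp: completion_times_def)
    have "?S \<subseteq> insert t (D \<inter> {..u - c})" by auto
    hence finS: "finite ?S" using fin finite_subset by blast
    have tS: "t \<in> ?S" using tu by auto
    \<comment> \<open>The last restart time that does not exceed \<open>u - c\<close>; local
      finiteness of \<open>D\<close> makes the maximum exist.\<close>
    define s where "s = Max ?S"
    have sS: "s \<in> ?S" unfolding s_def using finS tS by (intro Max_in) auto
    have mx: "x \<le> s" if "x \<in> ?S" for x unfolding s_def using finS that by simp
    have "x \<notin> {s<..<s + c}" if "x \<in> D" for x
    proof
      assume x: "x \<in> {s<..<s + c}"
      show False
      proof (cases "x \<le> u - c")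
        case True
        hence "x \<in> ?S" using x sS that by auto
        with mx[of x] x show False by auto
      next
        case False
        hence "x \<in> {u - c<..<u}" using x sS by auto
        with emp that show False by auto
      qed
    qed
    hence "s + c \<in> ?A" using sS by auto
    moreover have "s + c \<le> u" using sS by auto
    ultimately show ?thesis by blast
  qed
  show ?thesis
  proof (cases "?F = {}")
    \<comment> \<open>Both sides are then the same value \<open>Inf {}\<close>.\<close>
    case True
    with sub have A: "?A = {}" by blast
    show ?thesis unfolding task_finish_def by (simp only: A True)
  next
    case False
    then have ne: "?A \<noteq> {}" using ex by blast
    have "Inf ?A \<le> Inf ?F"
    proof (rule cInf_mono[OF False])
      show "bdd_below ?A" using completion_times_bdd_below sub by (rule bdd_below_mono)
    qed (use ex in blast)
    moreover have "Inf ?F \<le> Inf ?A"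
      by (rule cInf_superset_mono[OF ne completion_times_bdd_below sub])
    ultimately show ?thesis unfolding task_finish_def by (rule antisym)
  qed
qed

text \<open>Rules out the junk value \<open>Inf {}\<close> of \<open>task_finish\<close> along the schedule.\<close>

fun finishes :: "real set \<Rightarrow> real list \<Rightarrow> real \<Rightarrow> bool" where
  "finishes D [] t \<longleftrightarrow> True"
| "finishes D (c # cs) t \<longleftrightarrow>
     completion_times D c t \<noteq> {} \<and> finishes D cs (task_finish D c t)"

lemma seq_finish_append:
  "seq_finish D (cs @ ds) t = seq_finish D ds (seq_finish D cs t)"
  by (induction cs arbitrary: t) auto

lemma finishes_append:
  "finishes D (cs @ ds) t \<longleftrightarrow> finishes D cs t \<and> finishes D ds (seq_finish D cs t)"
  by (induction cs arbitrary: t) auto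

lemma seq_finish_ge:
  assumes fin: "\<And>b. finite (D \<inter> {..b})" and "\<forall>c\<in>set cs. c > 0" and "finishes D cs t"
  shows "t \<le> seq_finish D cs t"
  using assms(2,3)
proof (induction cs arbitrary: t)
  case (Cons c cs)
  have "t + c \<le> Inf (completion_times D c t)"
    by (rule cInf_greatest) (use Cons.prems in \<open>auto simp: completion_times_def\<close>)
  hence "t \<le> task_finish D c t"
    using task_finish_eq_Inf[OF fin, of c t] Cons.prems by simp
  with Cons.IH[of "task_finish D c t"] Cons.prems show ?case by simp
qed simp

section \<open>Pathwise comparison of the schedule with the chain\<close>

text \<open>Left-open cells tile the positive axis and match \<open>interval_count\<close>. A
  disruption at 0 lies in no cell; this is harmless because the intervals in
  \<open>completion_times\<close> are open.\<close>

definition occupied :: "real set \<Rightarrow> real \<Rightarrow> nat \<Rightarrow> bool" where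
  "occupied D h k \<longleftrightarrow> D \<inter> {h * real k<..h * real (Suc k)} \<noteq> {}"

lemma grid_cell_exists:
  assumes "h > 0" "h * real i < x" "x \<le> h * real j"
  obtains l where "i \<le> l" "l < j" "h * real l < x" "x \<le> h * real (Suc l)"
proof -
  \<comment> \<open>Ceiling minus one instead of floor, because cells are closed on the
    right.\<close>
  define l where "l = nat (\<lceil>x / h\<rceil> - 1)"
  have x: "real i < x / h" "x / h \<le> real j" using assms by (auto simp: field_simps)
  hence pos: "\<lceil>x / h\<rceil> \<ge> int i + 1" by linarith
  hence l: "real l = real_of_int \<lceil>x / h\<rceil> - 1" unfolding l_def by auto
  show thesis
  proof
    show "i \<le> l" using pos unfolding l_def by linarith
    show "l < j" using l x by linarith
    have "real l < x / h" "x / h \<le> real l + 1" using l by linarith+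
    thus "h * real l < x" "x \<le> h * real (Suc l)"
      using assms(1) by (auto simp: field_simps)
  qed
qed

lemma no_points_if_not_occupied:
  assumes "h > 0" "\<And>l. i \<le> l \<Longrightarrow> l < j \<Longrightarrow> \<not> occupied D h l"
  shows "D \<inter> {h * real i<..h * real j} = {}"
proof (rule ccontr)
  assume "D \<inter> {h * real i<..h * real j} \<noteq> {}"
  then obtain x where x: "x \<in> D" "h * real i < x" "x \<le> h * real j" by auto
  then obtain l where "i \<le> l" "l < j" "h * real l < x" "x \<le> h * real (Suc l)"
    using grid_cell_exists[OF assms(1)] by metis
  with assms(2) x(1) show False unfolding occupied_def by fastforce
qed

text \<open>With run lengths rounded up, the chain lags behind the schedule: the tasks
  \<open>ds\<close> that it has checked off really ended before its current run of \<open>a\<close>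
  empty cells began. Once that run has \<open>m c\<close> cells, it is long enough to hold a whole
  processing of \<open>c\<close>.\<close>

lemma grid_state_upper_invariant:
  assumes fin: "\<And>b. finite (D \<inter> {..b})" and h: "h > 0"
    and cs: "\<forall>c\<in>set cs. c > 0 \<and> c \<le> h * real (m c)"
  shows "\<exists>ds es a. cs = ds @ es \<and> grid_state (occupied D h) (map m cs) k = (map m es, a)
           \<and> finishes D ds 0 \<and> a \<le> k \<and> seq_finish D ds 0 \<le> h * real (k - a)
           \<and> (\<forall>l. k - a \<le> l \<longrightarrow> l < k \<longrightarrow> \<not> occupied D h l)"
proof (induction k)
  case 0
  show ?case by (rule exI[of _ "[]"]) simp
next
  case (Suc k)
  then obtain ds es a where IH: "cs = ds @ es"
    "grid_state (occupied D h) (map m cs) k = (map m es, a)" "finishes D ds 0" "a \<le> k"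
    "seq_finish D ds 0 \<le> h * real (k - a)"
    "\<forall>l. k - a \<le> l \<longrightarrow> l < k \<longrightarrow> \<not> occupied D h l"
    by blast
  have le: "seq_finish D ds 0 \<le> h * real (Suc k)"
    by (rule order_trans[OF IH(5)]) (use h in simp)
  show ?case
  proof (cases es)
    case Nil
    show ?thesis
      by (rule exI[of _ ds], rule exI[of _ "[]"], rule exI[of _ 0]) (use IH Nil le in simp)
  next
    case (Cons c es')
    consider "occupied D h k" | "\<not> occupied D h k" "Suc a \<noteq> m c"
      | "\<not> occupied D h k" "Suc a = m c" by blast
    thus ?thesis
    proof cases
      case 1
      show ?thesis
        by (rule exI[of _ ds], rule exI[of _ es], rule exI[of _ 0])
          (use 1 IH Cons le in simp)
    next
      case 2
      have "\<forall>l. k - a \<le> l \<longrightarrow> l < Suc k \<longrightarrow> \<not> occupied D h l"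
        using IH(6) 2 less_Suc_eq by blast
      thus ?thesis
        by (intro exI[of _ ds] exI[of _ es] exI[of _ "Suc a"]) (use 2 IH Cons in simp)
    next
      case 3
      let ?u = "h * real (Suc k)" and ?T = "seq_finish D ds 0"
      have c: "c > 0" "c \<le> h * real (m c)" using cs IH(1) Cons by auto
      have "real (k - a) + real (m c) = real (Suc k)" using 3 IH(4) by simp
      hence *: "h * real (k - a) + h * real (m c) = ?u"
        by (metis distrib_left)
      have "D \<inter> {h * real (k - a)<..?u} = {}"
        by (rule no_points_if_not_occupied[OF h]) (use IH(6) 3 less_Suc_eq in blast)
      moreover have "h * real (k - a) \<le> ?u - c" using * c by linarith
      ultimately have "D \<inter> {?u - c<..<?u} = {}" by fastforce
      hence u: "?u \<in> completion_times D c ?T"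
        unfolding completion_times_def using * c IH(5) by auto
      hence "Inf (completion_times D c ?T) \<le> ?u"
        by (rule cInf_lower[OF _ completion_times_bdd_below])
      hence "seq_finish D (ds @ [c]) 0 \<le> ?u"
        by (simp add: seq_finish_append task_finish_eq_Inf[OF fin c(1)])
      moreover have "finishes D (ds @ [c]) 0"
        using u IH(3) by (auto simp: finishes_append)
      ultimately show ?thesis
        by (intro exI[of _ "ds @ [c]"] exI[of _ es'] exI[of _ 0]) (use 3 IH Cons in simp)
    qed
  qed
qed

lemma seq_finish_le_grid:
  assumes "\<And>b. finite (D \<inter> {..b})" and "h > 0"
    and "\<forall>c\<in>set cs. c > 0 \<and> c \<le> h * real (m c)"
    and "fst (grid_state (occupied D h) (map m cs) k) = []"
  shows "finishes D cs 0" and "seq_finish D cs 0 \<le> h * real k"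
proof -
  obtain ds es a where *: "cs = ds @ es"
    "grid_state (occupied D h) (map m cs) k = (map m es, a)" "finishes D ds 0" "a \<le> k"
    "seq_finish D ds 0 \<le> h * real (k - a)"
    using grid_state_upper_invariant[OF assms(1-3)] by blast
  have "cs = ds" using * assms(4) by simp
  moreover have "h * real (k - a) \<le> h * real k" using assms(2) by simp
  ultimately show "finishes D cs 0" "seq_finish D cs 0 \<le> h * real k"
    using * by (auto intro: order_trans)
qed

lemma fst_grid_step:
  "fst (grid_step b s) = fst s \<or> fst (grid_step b s) = tl (fst s)"
  by (cases "(b, s)" rule: grid_step.cases) auto

lemma grid_state_length_antimono:
  "k \<le> k' \<Longrightarrow> length (fst (grid_state B ms k')) \<le> length (fst (grid_state B ms k))"
proof (induction k' rule: dec_induct)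
  case (step l)
  have "length (fst (grid_state B ms (Suc l))) \<le> length (fst (grid_state B ms l))"
    using fst_grid_step[of "B l" "grid_state B ms l"] by auto
  with step show ?case by linarith
qed simp

text \<open>The missing runs form a suffix of \<open>ms\<close>, so their number alone determines
  them.\<close>

lemma grid_state_drop: "\<exists>i. fst (grid_state B ms k) = drop i ms"
proof (induction k)
  case 0
  show ?case by (rule exI[of _ 0]) simp
next
  case (Suc k)
  thus ?case using fst_grid_step[of "B k" "grid_state B ms k"]
    by (metis drop_Suc grid_state.simps(2) tl_drop)
qed

lemma grid_state_invariant:
  assumes "\<forall>m\<in>set ms. m > 0" and "grid_state B ms k = (ns, a)"
  shows "ns = [] \<longrightarrow> a = 0" and "ns \<noteq> [] \<longrightarrow> a < hd ns"
proof -
  \<comment> \<open>The inclusion is added so that positivity passes to the next run when the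
    counter returns to 0.\<close>
  have "set ns \<subseteq> set ms \<and> (ns = [] \<longrightarrow> a = 0) \<and> (ns \<noteq> [] \<longrightarrow> a < hd ns)"
    using assms(2)
  proof (induction k arbitrary: ns a)
    case 0
    thus ?case using assms(1) by (cases ns) auto
  next
    case (Suc k)
    obtain ns' a' where s: "grid_state B ms k = (ns', a')" by force
    note IH = Suc.IH[OF s]
    show ?case
    proof (cases ns')
      case Nil
      thus ?thesis using Suc.prems s by auto
    next
      case (Cons m xs)
      hence "\<forall>x\<in>set xs. x > 0" "m > 0" "a' < m" using IH assms(1) by auto
      thus ?thesis using Suc.prems s Cons IH by (cases xs) (auto split: if_splits)
    qed
  qed
  thus "ns = [] \<longrightarrow> a = 0" "ns \<noteq> [] \<longrightarrow> a < hd ns" by auto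
qed

text \<open>The counter at \<open>k\<close> may already be positive, so the run can end before
  \<open>k + m\<close> and later runs may begin; hence only a bound on the number of missing
  runs.\<close>

lemma grid_state_run:
  assumes pos: "\<forall>m\<in>set ms. m > 0" and k: "fst (grid_state B ms k) = m # ns"
    and run: "\<And>l. k \<le> l \<Longrightarrow> l < k + m \<Longrightarrow> \<not> B l"
  shows "length (fst (grid_state B ms (k + m))) \<le> length ns"
proof -
  obtain a where s: "grid_state B ms k = (m # ns, a)" using k by (metis prod.collapse)
  have a: "a < m" using grid_state_invariant(2)[OF pos s] by simp
  have "grid_state B ms (k + d) = (m # ns, a + d)" if "a + d < m" for d
    using that
  proof (induction d)
    case (Suc d)
    thus ?case using run[of "k + d"] by simp
  qed (simp add: s)
  from this[of "m - Suc a"] a have "grid_state B ms (k + (m - Suc a)) = (m # ns, m - 1)"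
    by simp
  moreover have "\<not> B (k + (m - Suc a))" using run a by simp
  ultimately have "fst (grid_state B ms (Suc (k + (m - Suc a)))) = ns" using a by auto
  moreover have "Suc (k + (m - Suc a)) \<le> k + m" using a by linarith
  ultimately show ?thesis
    using grid_state_length_antimono[of "Suc (k + (m - Suc a))" "k + m" B ms] by metis
qed

text \<open>With run lengths rounded down, the chain is never behind the schedule: a disruption-free
  interval of length \<open>c\<close> contains \<open>m c\<close> whole cells, the two spare cells
  absorbing the partial cells at its ends.\<close>

lemma grid_state_lower_invariant:
  assumes fin: "\<And>b. finite (D \<inter> {..b})" and h: "h > 0"
    and cs: "\<forall>c\<in>set cs. m c > 0 \<and> h * real (m c + 2) \<le> c"
    and "finishes D cs 0" and "cs = ds @ es" and "seq_finish D ds 0 < h * real k"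
  shows "length (fst (grid_state (occupied D h) (map m cs) k)) \<le> length es"
  using assms(4-)
proof (induction ds arbitrary: es k rule: rev_induct)
  case Nil
  thus ?case using grid_state_length_antimono[of 0 k "occupied D h" "map m cs"] by simp
next
  case (snoc c ds)
  let ?T = "seq_finish D ds 0" and ?s = "grid_state (occupied D h) (map m cs)"
  have mc: "m c > 0" "h * real (m c + 2) \<le> c" using cs snoc.prems by auto
  have pos: "\<forall>c\<in>set cs. c > 0"
  proof
    fix x assume "x \<in> set cs"
    hence "h * real (m x + 2) \<le> x" using cs by blast
    moreover have "0 < h * real (m x + 2)" using h by simp
    ultimately show "x > 0" by linarith
  qed
  hence c: "c > 0" using snoc.prems by auto
  have fins: "finishes D ds 0" "completion_times D c ?T \<noteq> {}"
    using snoc.prems by (auto simp: finishes_append)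
  have T: "?T \<ge> 0" by (rule seq_finish_ge[OF fin _ fins(1)]) (use pos snoc.prems in auto)
  have "Inf (completion_times D c ?T) < h * real k"
    using snoc.prems(3) by (simp add: seq_finish_append task_finish_eq_Inf[OF fin c])
  \<comment> \<open>The strict bound yields an actual completion time without showing that the
    infimum is attained.\<close>
  then obtain u where u: "u \<in> completion_times D c ?T" "u < h * real k"
    using cInf_lessD[OF fins(2)] by blast
  hence u': "?T + c \<le> u" "D \<inter> {u - c<..<u} = {}" by (auto simp: completion_times_def)
  have "h * real 0 < u" using u' T c by simp
  \<comment> \<open>Cell \<open>j\<close> contains \<open>u\<close>. The \<open>m c\<close> cells
    before it lie inside \<open>(u - c, u)\<close> and start after \<open>?T\<close>, so the
    induction hypothesis applies at \<open>j - m c\<close>.\<close>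
  then obtain j where j: "j < k" "h * real j < u" "u \<le> h * real (Suc j)"
    using grid_cell_exists[OF h, of 0 u k] u(2) by (metis less_imp_le)
  have jh: "u - h \<le> h * real j" using j(3) by (simp add: algebra_simps)
  have hm: "h * real (m c) + 2 * h \<le> c" using mc(2) by (simp add: algebra_simps)
  have "h * real (m c) < h * real j" using jh hm u' T h by linarith
  hence mj: "m c \<le> j" using h by simp
  have jm: "h * real (j - m c) = h * real j - h * real (m c)"
    using mj by (simp add: of_nat_diff right_diff_distrib)
  have "?T < h * real (j - m c)" using jm jh hm u' h by linarith
  hence IH: "length (fst (?s (j - m c))) \<le> length (c # es)"
    using snoc.IH[of "c # es" "j - m c"] snoc.prems by simp
  have anti: "length (fst (?s k)) \<le> length (fst (?s j))"
    using grid_state_length_antimono j(1) by simp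
  show ?case
  \<comment> \<open>Either the chain is already past \<open>c\<close> at \<open>j - m c\<close>, or
    the length of its missing list identifies that list, whose first entry is
    \<open>m c\<close>.\<close>
  proof (cases "length (fst (?s (j - m c))) \<le> length es")
    case True
    thus ?thesis using anti grid_state_length_antimono[of "j - m c" j "occupied D h" "map m cs"]
      by simp
  next
    case False
    obtain i where i: "fst (?s (j - m c)) = drop i (map m cs)"
      using grid_state_drop by blast
    have "length (drop i (map m cs)) = Suc (length es)" using IH False i by simp
    hence "i = length ds" using snoc.prems by simp
    hence eq: "fst (?s (j - m c)) = m c # map m es" using i snoc.prems by simp
    have "\<not> occupied D h l" if l: "j - m c \<le> l" "l < j - m c + m c" for l
    proof
      assume "occupied D h l"
      then obtain x where x: "x \<in> D" "h * real l < x" "x \<le> h * real (Suc l)"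
        by (auto simp: occupied_def)
      have "h * real (Suc l) \<le> h * real j" using l mj h
        by (intro mult_left_mono) auto
      moreover have "h * real (j - m c) \<le> h * real l" using l h by simp
      ultimately have "x < u" "u - c < x" using x(2,3) jm jh hm j(2) h by linarith+
      with u'(2) x(1) show False by auto
    qed
    hence "length (fst (?s (j - m c + m c))) \<le> length (map m es)"
      by (intro grid_state_run eq) (use cs in auto)
    thus ?thesis using anti mj by simp
  qed
qed

lemma seq_finish_ge_grid:
  assumes "\<And>b. finite (D \<inter> {..b})" and "h > 0"
    and "\<forall>c\<in>set cs. m c > 0 \<and> h * real (m c + 2) \<le> c" and "finishes D cs 0"
    and "fst (grid_state (occupied D h) (map m cs) k) \<noteq> []"
  shows "h * real k \<le> seq_finish D cs 0"
  using grid_state_lower_invariant[OF assms(1-4), of cs "[]" k] assms(5) by force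

text \<open>A finished chain stays finished, so this counts the cells needed, with value \<infinity>
  if the runs are never all seen. As a series it can be integrated term by term.\<close>

definition grid_makespan :: "(nat \<Rightarrow> bool) \<Rightarrow> nat list \<Rightarrow> ennreal" where
  "grid_makespan B ms = (\<Sum>k. of_bool (fst (grid_state B ms k) \<noteq> []))"

text \<open>No \<open>finishes\<close> is assumed: a chain that finishes certifies it, and otherwise
  the right-hand side is infinite.\<close>

lemma seq_finish_le_grid_makespan:
  assumes "\<And>b. finite (D \<inter> {..b})" and h: "h > 0"
    and "\<forall>c\<in>set cs. c > 0 \<and> c \<le> h * real (m c)"
  shows "ennreal (seq_finish D cs 0) \<le> ennreal h * grid_makespan (occupied D h) (map m cs)"
proof -
  let ?T = "seq_finish D cs 0" and ?B = "\<lambda>k. fst (grid_state (occupied D h) (map m cs) k) \<noteq> []"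
  define n where "n = nat \<lceil>?T / h\<rceil>"
  have nf: "?B k" if "k < n" for k
  proof (rule ccontr)
    assume "\<not> ?B k"
    hence "?T \<le> h * real k" using seq_finish_le_grid(2)[OF assms] by blast
    hence "?T / h \<le> real k" using h by (simp add: field_simps)
    with that show False unfolding n_def by linarith
  qed
  have "?T / h \<le> real n" unfolding n_def by linarith
  hence "?T \<le> h * real n" using h by (simp add: field_simps)
  hence "ennreal ?T \<le> ennreal (h * real n)" by (rule ennreal_leI)
  also have "\<dots> = ennreal h * (\<Sum>k<n. of_bool (?B k))"
    using nf h by (simp add: ennreal_mult ennreal_of_nat_eq_real_of_nat)
  also have "\<dots> \<le> ennreal h * grid_makespan (occupied D h) (map m cs)"
    unfolding grid_makespan_def by (intro mult_left_mono sum_le_suminf) auto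
  finally show ?thesis .
qed

text \<open>The chain is unfinished only at indices \<open>k\<close> with \<open>h * k\<close> at
  most the finish time. Counting these from \<open>k = 0\<close> costs the extra
  \<open>h\<close>.\<close>

lemma grid_makespan_le_seq_finish:
  assumes "\<And>b. finite (D \<inter> {..b})" and h: "h > 0"
    and "\<forall>c\<in>set cs. m c > 0 \<and> h * real (m c + 2) \<le> c" and "finishes D cs 0"
  shows "ennreal h * grid_makespan (occupied D h) (map m cs)
           \<le> ennreal (seq_finish D cs 0) + ennreal h"
proof -
  let ?T = "seq_finish D cs 0" and ?B = "\<lambda>k. fst (grid_state (occupied D h) (map m cs) k) \<noteq> []"
  have "\<forall>c\<in>set cs. c > 0"
  proof
    fix x assume "x \<in> set cs"
    hence "h * real (m x + 2) \<le> x" using assms(3) by blast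
    moreover have "0 < h * real (m x + 2)" using h by simp
    ultimately show "x > 0" by linarith
  qed
  hence T: "?T \<ge> 0" using seq_finish_ge[OF assms(1) _ assms(4)] by simp
  define n where "n = Suc (nat \<lfloor>?T / h\<rfloor>)"
  have f: "\<not> ?B k" if "k \<notin> {..<n}" for k
  proof
    assume "?B k"
    hence "h * real k \<le> ?T" using seq_finish_ge_grid[OF assms] by blast
    hence "real k \<le> ?T / h" using h by (simp add: field_simps)
    hence "k \<le> nat \<lfloor>?T / h\<rfloor>" by (rule le_nat_floor)
    with that show False unfolding n_def by simp
  qed
  have "grid_makespan (occupied D h) (map m cs) = (\<Sum>k<n. of_bool (?B k))"
    unfolding grid_makespan_def by (rule suminf_finite) (use f in auto)
  also have "\<dots> \<le> (\<Sum>k<n. 1)" by (intro sum_mono) auto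
  also have "\<dots> = ennreal (real n)" by (simp add: ennreal_of_nat_eq_real_of_nat)
  finally have "ennreal h * grid_makespan (occupied D h) (map m cs) \<le> ennreal h * ennreal (real n)"
    by (rule mult_left_mono) simp
  also have "\<dots> = ennreal (h * real n)" using h by (simp add: ennreal_mult)
  also have "\<dots> \<le> ennreal (?T + h)"
  proof (rule ennreal_leI)
    have "real n \<le> ?T / h + 1" unfolding n_def using T h by simp
    hence "h * real n \<le> h * (?T / h + 1)" using h by (intro mult_left_mono) auto
    also have "\<dots> = ?T + h" using h by (simp add: field_simps)
    finally show "h * real n \<le> ?T + h" .
  qed
  also have "\<dots> = ennreal ?T + ennreal h" using T h by simp
  finally show ?thesis .
qed

section \<open>The first \<open>N\<close> cells and the potential\<close>

lemma grid_state_cong: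
  "(\<And>i. i < k \<Longrightarrow> B i = B' i) \<Longrightarrow> grid_state B ms k = grid_state B' ms k"
  by (induction k) auto

text \<open>The list \<open>[Suc N]\<close> serves as a reference: its run cannot end within
  \<open>N\<close> cells, so until then its counter agrees with that of every list whose first run
  exceeds \<open>N\<close>. This is where tasks longer than \<open>t0\<close> matter.\<close>

lemma grid_state_before:
  assumes "N < m" and "k \<le> N"
  shows "grid_state B (m # ms) k = (m # ms, snd (grid_state B [Suc N] k))
           \<and> fst (grid_state B [Suc N] k) = [Suc N] \<and> snd (grid_state B [Suc N] k) \<le> k"
  using assms(2)
proof (induction k)
  case (Suc k)
  then obtain a where "grid_state B [Suc N] k = ([Suc N], a)" "a \<le> k"
    by (metis Suc_leD prod.collapse)
  with Suc assms(1) show ?case by auto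
qed simp

text \<open>With \<open>1 / r\<close> the probability of an empty cell, \<open>potential r s / (1 - 1 / r)\<close> is the mean
  number of further cells needed from the state \<open>s\<close>.\<close>

fun potential :: "real \<Rightarrow> nat list \<times> nat \<Rightarrow> real" where
  "potential r (ms, a) = (\<Sum>m\<leftarrow>ms. r ^ m - 1) + 1 - r ^ a"

text \<open>With counter \<open>a\<close>, an empty cell changes the potential by
  \<open>r ^ a - r ^ Suc a\<close> whether it extends the run or completes it, so one formula covers
  both cases.\<close>

lemma potential_grid_step:
  assumes "fst s = [] \<longrightarrow> snd s = 0"
  shows "potential r (grid_step b s) = potential r s
    + of_bool (fst s \<noteq> []) * (r ^ snd s - of_bool b - r * (r ^ snd s * of_bool (\<not> b)))"
  using assms by (cases "(b, s)" rule: grid_step.cases) auto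

text \<open>Nonnegativity holds because the counter stays below the current run length. The upper
  bound lets the mean potential be controlled by the probability of being unfinished.\<close>

lemma potential_bounds:
  assumes r: "r \<ge> (1 :: real)" and pos: "\<forall>m\<in>set ms. m > 0"
  shows "0 \<le> potential r (grid_state B ms k)"
    and "potential r (grid_state B ms k)
           \<le> (\<Sum>m\<leftarrow>ms. r ^ m - 1) * of_bool (fst (grid_state B ms k) \<noteq> [])"
proof -
  obtain ns a where s: "grid_state B ms k = (ns, a)" by force
  obtain i where i: "ns = drop i ms" using grid_state_drop[of B ms k] s by auto
  have nn: "0 \<le> (\<Sum>m\<leftarrow>xs. r ^ m - 1)" for xs
    by (rule sum_list_nonneg) (use r in auto)
  have ra: "1 \<le> r ^ a" using r by simp
  note inv = grid_state_invariant[OF pos s]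
  show "0 \<le> potential r (grid_state B ms k)"
  proof (cases ns)
    case Nil
    thus ?thesis using inv s by simp
  next
    case (Cons m xs)
    hence "r ^ a \<le> r ^ m" using inv r by (intro power_increasing) auto
    thus ?thesis using s Cons nn[of xs] by simp
  qed
  have "(\<Sum>m\<leftarrow>ms. r ^ m - 1) = (\<Sum>m\<leftarrow>take i ms. r ^ m - 1) + (\<Sum>m\<leftarrow>drop i ms. r ^ m - 1)"
    by (metis append_take_drop_id map_append sum_list_append)
  hence "(\<Sum>m\<leftarrow>ns. r ^ m - 1) \<le> (\<Sum>m\<leftarrow>ms. r ^ m - 1)" using nn[of "take i ms"] i by simp
  thus "potential r (grid_state B ms k)
      \<le> (\<Sum>m\<leftarrow>ms. r ^ m - 1) * of_bool (fst (grid_state B ms k) \<noteq> [])"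
    using s inv ra by (cases ns) auto
qed

section \<open>Mean of the discrete makespan\<close>

text \<open>\<open>B k\<close> says that cell \<open>k\<close> is occupied. Cells before
  \<open>N\<close> are independent with arbitrary laws; from \<open>N\<close> on each is empty with
  probability \<open>q\<close>.\<close>

locale bernoulli_grid = prob_space M for M :: "'a measure" +
  fixes B :: "nat \<Rightarrow> 'a \<Rightarrow> bool" and q :: real and N :: nat
  assumes indep: "indep_vars (\<lambda>_. count_space UNIV) B {..<K}"
    and prob_occupied: "N \<le> k \<Longrightarrow> prob {\<omega> \<in> space M. B k \<omega>} = 1 - q"
    and q_pos: "0 < q" and q_less_1: "q < 1"
begin

abbreviation state :: "nat list \<Rightarrow> nat \<Rightarrow> 'a \<Rightarrow> nat list \<times> nat" where
  "state ms k \<omega> \<equiv> grid_state (\<lambda>i. B i \<omega>) ms k"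

lemma B_measurable [measurable]: "B k \<in> measurable M (count_space UNIV)"
  using indep[of "Suc k"] by (auto simp: indep_vars_def)

text \<open>The state at \<open>k\<close> is a function of the cells before
  \<open>k\<close>.\<close>

lemma indep_state_B:
  fixes g1 :: "nat list \<times> nat \<Rightarrow> real" and g2 :: "bool \<Rightarrow> real"
  shows "indep_var borel (\<lambda>\<omega>. g1 (state ms k \<omega>)) borel (\<lambda>\<omega>. g2 (B k \<omega>))"
proof -
  let ?S = "count_space UNIV :: bool measure"
  have "indep_var (PiM {..<k} (\<lambda>_. ?S)) (\<lambda>\<omega>. restrict (\<lambda>i. B i \<omega>) {..<k})
      (PiM {k} (\<lambda>_. ?S)) (\<lambda>\<omega>. restrict (\<lambda>i. B i \<omega>) {k})"
    by (rule indep_var_restrict[OF indep[of "Suc k"]]) auto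
  from indep_var_compose[OF this, of "\<lambda>b. g1 (grid_state b ms k)" borel "\<lambda>b. g2 (b k)" borel]
  have "indep_var borel ((\<lambda>b. g1 (grid_state b ms k)) \<circ> (\<lambda>\<omega>. restrict (\<lambda>i. B i \<omega>) {..<k}))
      borel ((\<lambda>b. g2 (b k)) \<circ> (\<lambda>\<omega>. restrict (\<lambda>i. B i \<omega>) {k}))"
    by (simp add: count_space_PiM_finite)
  moreover have "grid_state (restrict (\<lambda>i. B i \<omega>) {..<k}) ms k = state ms k \<omega>" for \<omega>
    by (rule grid_state_cong) simp
  ultimately show ?thesis by (simp add: o_def)
qed

text \<open>The state is determined by \<open>k\<close> Booleans, so it takes finitely many values
  and \<open>g\<close> is bounded on them.\<close>

lemma integrable_state:
  fixes g :: "nat list \<times> nat \<Rightarrow> real"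
  shows "integrable M (\<lambda>\<omega>. g (state ms k \<omega>))"
proof -
  let ?V = "(\<lambda>b. \<bar>g (grid_state b ms k)\<bar>) ` ({..<k} \<rightarrow>\<^sub>E UNIV)"
  have "finite ?V" by (intro finite_imageI finite_PiE) auto
  moreover have "\<bar>g (state ms k \<omega>)\<bar> \<in> ?V" for \<omega>
  proof
    show "\<bar>g (state ms k \<omega>)\<bar> = \<bar>g (grid_state (restrict (\<lambda>i. B i \<omega>) {..<k}) ms k)\<bar>"
      by (intro arg_cong[where f = "\<lambda>s. \<bar>g s\<bar>"] grid_state_cong) simp
  qed auto
  ultimately have "\<bar>g (state ms k \<omega>)\<bar> \<le> Max ?V" for \<omega> by (intro Max_ge)
  moreover have "(\<lambda>\<omega>. g (state ms k \<omega>)) \<in> borel_measurable M"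
    using indep_var_rv1[OF indep_state_B[of g ms k "\<lambda>_. 0"]] .
  ultimately show ?thesis by (intro integrable_const_bound[of _ "Max ?V"]) auto
qed

lemma expectation_state_times_B:
  fixes g :: "nat list \<times> nat \<Rightarrow> real"
  assumes "N \<le> k"
  shows "expectation (\<lambda>\<omega>. g (state ms k \<omega>) * of_bool (B k \<omega>))
           = expectation (\<lambda>\<omega>. g (state ms k \<omega>)) * (1 - q)" (is ?occ)
    and "expectation (\<lambda>\<omega>. g (state ms k \<omega>) * of_bool (\<not> B k \<omega>))
           = expectation (\<lambda>\<omega>. g (state ms k \<omega>)) * q" (is ?emp)
    and "integrable M (\<lambda>\<omega>. g (state ms k \<omega>) * of_bool (B k \<omega>))"
    and "integrable M (\<lambda>\<omega>. g (state ms k \<omega>) * of_bool (\<not> B k \<omega>))"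
proof -
  have int: "integrable M (\<lambda>\<omega>. of_bool (B k \<omega>) :: real)"
    "integrable M (\<lambda>\<omega>. of_bool (\<not> B k \<omega>) :: real)"
    by (rule integrable_const_bound[of _ 1]; simp)+
  have "expectation (\<lambda>\<omega>. of_bool (B k \<omega>)) = expectation (indicator {\<omega> \<in> space M. B k \<omega>})"
    by (intro Bochner_Integration.integral_cong) (auto simp: indicator_def)
  also have "\<dots> = prob {\<omega> \<in> space M. B k \<omega>}" by simp
  finally have occ: "expectation (\<lambda>\<omega>. of_bool (B k \<omega>)) = 1 - q"
    using prob_occupied[OF assms] by simp
  have "expectation (\<lambda>\<omega>. of_bool (\<not> B k \<omega>)) = expectation (\<lambda>\<omega>. 1 - of_bool (B k \<omega>))"
    by (intro Bochner_Integration.integral_cong) auto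
  also have "\<dots> = q" using int occ by (simp add: prob_space)
  finally have emp: "expectation (\<lambda>\<omega>. of_bool (\<not> B k \<omega>)) = q" .
  show ?occ
    using indep_var_lebesgue_integral[OF indep_state_B[of g ms k of_bool] integrable_state int(1)]
      occ by simp
  show ?emp
    using indep_var_lebesgue_integral[OF indep_state_B[of g ms k "\<lambda>b. of_bool (\<not> b)"]
        integrable_state int(2)] emp by simp
  show "integrable M (\<lambda>\<omega>. g (state ms k \<omega>) * of_bool (B k \<omega>))"
    by (rule indep_var_integrable[OF indep_state_B[of g ms k of_bool] integrable_state int(1)])
  show "integrable M (\<lambda>\<omega>. g (state ms k \<omega>) * of_bool (\<not> B k \<omega>))"
    by (rule indep_var_integrable[OF indep_state_B[of g ms k "\<lambda>b. of_bool (\<not> b)"]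
        integrable_state int(2)])
qed

abbreviation unfinished :: "nat list \<Rightarrow> nat \<Rightarrow> 'a \<Rightarrow> real" where
  "unfinished ms k \<omega> \<equiv> of_bool (fst (state ms k \<omega>) \<noteq> [])"

text \<open>An empty cell has probability \<open>q\<close> and multiplies the power of
  \<open>1 / q\<close> in the counter term by \<open>1 / q\<close>, so these terms cancel in the
  mean; only the drift \<open>1 - q\<close> of an unfinished chain remains.\<close>

lemma expectation_potential_step:
  assumes "N \<le> k" and pos: "\<forall>m\<in>set ms. m > 0"
  shows "expectation (\<lambda>\<omega>. potential (1 / q) (state ms (Suc k) \<omega>))
    = expectation (\<lambda>\<omega>. potential (1 / q) (state ms k \<omega>))
      - (1 - q) * expectation (unfinished ms k)"
proof -
  let ?r = "1 / q" and ?s = "state ms k"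
  let ?g = "\<lambda>s :: nat list \<times> nat. of_bool (fst s \<noteq> []) * ?r ^ snd s :: real"
  let ?n = "\<lambda>s :: nat list \<times> nat. of_bool (fst s \<noteq> []) :: real"
  have "fst (?s \<omega>) = [] \<longrightarrow> snd (?s \<omega>) = 0" for \<omega>
    using grid_state_invariant(1)[OF pos, of "\<lambda>i. B i \<omega>" k] by (metis prod.collapse)
  hence eq: "potential ?r (state ms (Suc k) \<omega>) = potential ?r (?s \<omega>) + ?g (?s \<omega>)
      - ?n (?s \<omega>) * of_bool (B k \<omega>) - ?r * (?g (?s \<omega>) * of_bool (\<not> B k \<omega>))" for \<omega>
    by (simp add: potential_grid_step algebra_simps)
  note E = expectation_state_times_B[OF assms(1)]
  note I = integrable_state[of "potential ?r" ms k] integrable_state[of ?g ms k]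
    E(3)[of ?n ms] E(4)[of ?g ms]
  have "expectation (\<lambda>\<omega>. potential ?r (state ms (Suc k) \<omega>))
     = expectation (\<lambda>\<omega>. potential ?r (?s \<omega>)) + expectation (\<lambda>\<omega>. ?g (?s \<omega>))
      - expectation (\<lambda>\<omega>. ?n (?s \<omega>) * of_bool (B k \<omega>))
      - ?r * expectation (\<lambda>\<omega>. ?g (?s \<omega>) * of_bool (\<not> B k \<omega>))"
    unfolding eq
    by (subst Bochner_Integration.integral_diff Bochner_Integration.integral_add
        integral_mult_right_zero; (intro Bochner_Integration.integrable_diff
          Bochner_Integration.integrable_add integrable_mult_right I)?)+ (rule refl)
  also have "\<dots> = expectation (\<lambda>\<omega>. potential ?r (?s \<omega>)) - (1 - q) * expectation (\<lambda>\<omega>. ?n (?s \<omega>))"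
    unfolding E(1)[of ?n ms] E(2)[of ?g ms] using q_pos by simp
  finally show ?thesis .
qed

text \<open>From \<open>N\<close> on the drift telescopes. Since the potential is nonnegative, the
  partial sums are bounded, so the probability of being unfinished tends to 0, and by
  \<open>potential_bounds\<close> so does the mean potential.\<close>

lemma unfinished_sums:
  assumes "ms \<noteq> []" and ms: "\<forall>m\<in>set ms. N < m"
  shows "(\<lambda>k. expectation (unfinished ms k)) sums
    (real N + ((\<Sum>m\<leftarrow>ms. (1 / q) ^ m - 1) + 1
       - expectation (\<lambda>\<omega>. (1 / q) ^ snd (state [Suc N] N \<omega>))) / (1 - q))"
proof -
  let ?r = "1 / q" and ?p = "\<lambda>k. expectation (unfinished ms k)"
  let ?U = "\<lambda>k. expectation (\<lambda>\<omega>. potential ?r (state ms k \<omega>))"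
  let ?C = "\<Sum>m\<leftarrow>ms. ?r ^ m - 1"
  have r: "?r \<ge> 1" using q_pos q_less_1 by simp
  have pos: "\<forall>m\<in>set ms. m > 0" using ms by auto
  have U_nonneg: "0 \<le> ?U k" for k
    by (intro integral_nonneg_AE AE_I2 potential_bounds r pos)
  have U_le: "?U k \<le> ?C * ?p k" for k
  proof -
    have "?U k \<le> expectation (\<lambda>\<omega>. ?C * unfinished ms k \<omega>)"
      by (intro integral_mono integrable_state integrable_mult_right potential_bounds r pos
          integrable_state[of "\<lambda>s. of_bool (fst s \<noteq> [])"])
    thus ?thesis by simp
  qed
  have p_nonneg: "0 \<le> ?p k" for k by (intro integral_nonneg_AE AE_I2) simp
  have part: "(\<Sum>k<K. ?p (k + N)) = (?U N - ?U (K + N)) / (1 - q)" for K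
  proof (induction K)
    case (Suc K)
    show ?case using q_less_1 expectation_potential_step[of "K + N" ms] pos
      by (simp add: Suc field_simps del: grid_state.simps)
  qed simp
  have "summable (\<lambda>k. ?p (k + N))"
  proof (rule summableI_nonneg_bounded)
    show "(\<Sum>k<K. ?p (k + N)) \<le> ?U N / (1 - q)" for K
      unfolding part using U_nonneg[of "K + N"] q_less_1 by (intro divide_right_mono) auto
  qed (rule p_nonneg)
  hence p0: "(\<lambda>k. ?p (k + N)) \<longlonglongrightarrow> 0" by (rule summable_LIMSEQ_zero)
  have "(\<lambda>K. ?U (K + N)) \<longlonglongrightarrow> 0"
  proof (rule tendsto_sandwich[OF _ _ tendsto_const])
    show "(\<lambda>K. ?C * ?p (K + N)) \<longlonglongrightarrow> 0" using tendsto_mult_right_zero[OF p0] .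
  qed (use U_nonneg U_le in auto)
  hence "(\<lambda>K. (?U N - ?U (K + N)) / (1 - q)) \<longlonglongrightarrow> (?U N - 0) / (1 - q)"
    using q_less_1 by (intro tendsto_intros) auto
  hence "(\<lambda>k. ?p (k + N)) sums (?U N / (1 - q))" unfolding sums_def part by simp
  hence sums: "?p sums (?U N / (1 - q) + (\<Sum>k<N. ?p k))" by (subst (asm) sums_iff_shift)
  obtain m ns where mns: "ms = m # ns" using assms(1) by (cases ms) auto
  \<comment> \<open>Before \<open>N\<close> the chain is surely unfinished, and at \<open>N\<close>
    its counter does not depend on \<open>ms\<close>.\<close>
  have st: "state ms k \<omega> = (ms, snd (state [Suc N] k \<omega>))" if "k \<le> N" for k \<omega>
    using grid_state_before[of N m k "\<lambda>i. B i \<omega>" ns] that ms mns by simp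
  have "?p k = 1" if "k < N" for k using st[of k] that assms(1) by (simp add: prob_space)
  moreover have "?U N = ?C + 1 - expectation (\<lambda>\<omega>. ?r ^ snd (state [Suc N] N \<omega>))"
    using integrable_state[of "\<lambda>s. ?r ^ snd s" "[Suc N]" N]
    by (simp add: st prob_space del: grid_state.simps)
  ultimately show ?thesis using sums by (simp add: add.commute)
qed

text \<open>\<open>S\<close> is symmetric in \<open>ms\<close>: the order enters neither the sum nor
  the term for \<open>[Suc N]\<close>.\<close>

lemma nn_integral_grid_makespan:
  fixes ms
  defines "S \<equiv> real N + ((\<Sum>m\<leftarrow>ms. (1 / q) ^ m - 1) + 1
       - expectation (\<lambda>\<omega>. (1 / q) ^ snd (state [Suc N] N \<omega>))) / (1 - q)"
  assumes "ms \<noteq> []" and "\<forall>m\<in>set ms. N < m"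
  shows "(\<integral>\<^sup>+ \<omega>. grid_makespan (\<lambda>k. B k \<omega>) ms \<partial>M) = ennreal S" and "0 \<le> S"
    and "(\<lambda>\<omega>. grid_makespan (\<lambda>k. B k \<omega>) ms) \<in> borel_measurable M"
proof -
  note sums = unfinished_sums[OF assms(2,3), folded S_def]
  have eq: "grid_makespan (\<lambda>k. B k \<omega>) ms = (\<Sum>k. ennreal (unfinished ms k \<omega>))" for \<omega>
    by (simp add: grid_makespan_def of_bool_def if_distrib cong: if_cong)
  note I = integrable_state[of "\<lambda>s. of_bool (fst s \<noteq> [])" ms]
  have [measurable]: "unfinished ms k \<in> borel_measurable M" for k
    by (rule borel_measurable_integrable[OF I])
  show "(\<lambda>\<omega>. grid_makespan (\<lambda>k. B k \<omega>) ms) \<in> borel_measurable M" unfolding eq by measurable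
  have nn: "0 \<le> expectation (unfinished ms k)" for k
    by (intro integral_nonneg_AE AE_I2) simp
  have "(\<integral>\<^sup>+ \<omega>. grid_makespan (\<lambda>k. B k \<omega>) ms \<partial>M) = (\<Sum>k. \<integral>\<^sup>+ \<omega>. ennreal (unfinished ms k \<omega>) \<partial>M)"
    unfolding eq by (rule nn_integral_suminf) measurable
  also have "\<dots> = (\<Sum>k. ennreal (expectation (unfinished ms k)))"
    by (intro suminf_cong nn_integral_eq_integral I AE_I2) simp
  also have "\<dots> = ennreal (\<Sum>k. expectation (unfinished ms k))"
    by (rule suminf_ennreal2[OF nn sums_summable[OF sums]])
  finally show "(\<integral>\<^sup>+ \<omega>. grid_makespan (\<lambda>k. B k \<omega>) ms \<partial>M) = ennreal S"
    using sums_unique[OF sums] by simp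
  show "0 \<le> S" using suminf_nonneg[OF sums_summable[OF sums] nn] sums_unique[OF sums] by simp
qed

end

section \<open>Cells of the Poisson process\<close>

text \<open>Past \<open>h * N\<close> the count of a cell is Poisson with mean \<open>L * h\<close>,
  hence 0 with probability \<open>exp (- (L * h))\<close>. Counts are used instead of
  \<open>occupied\<close> because \<open>nhpp\<close> speaks of them.\<close>

lemma nhpp_bernoulli_grid:
  fixes D :: "'w \<Rightarrow> real set"
  assumes pp: "nhpp P lam D" and h: "h > 0" and L: "L > 0"
    and lam: "\<And>t. h * real N \<le> t \<Longrightarrow> lam t = L"
  shows "bernoulli_grid P (\<lambda>k \<omega>. interval_count D (h * real k) (h * real (Suc k)) \<omega> \<noteq> 0)
           (exp (- (L * h))) N"
proof -
  let ?X = "\<lambda>k. interval_count D (h * real k) (h * real (Suc k))"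
  let ?S = "count_space UNIV :: nat measure"
  interpret prob_space P using pp by (simp add: nhpp_def)
  have le: "h * real k \<le> h * real (Suc k)" "0 \<le> h * real k" for k using h by simp_all
  have disj: "disjoint_family_on (\<lambda>i. {h * real i<..h * real (Suc i)}) {..<K}" for K
    unfolding disjoint_family_on_def
  proof (intro ballI impI)
    fix i j :: nat assume "i \<noteq> j"
    hence "real (Suc i) \<le> real j \<or> real (Suc j) \<le> real i" by linarith
    hence "h * real (Suc i) \<le> h * real j \<or> h * real (Suc j) \<le> h * real i"
      using h by (auto intro: mult_left_mono simp del: of_nat_Suc)
    thus "{h * real i<..h * real (Suc i)} \<inter> {h * real j<..h * real (Suc j)} = {}" by fastforce
  qed
  have iv: "(\<forall>i<K. 0 \<le> fst (I i) \<and> fst (I i) \<le> snd (I i)) \<Longrightarrow>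
      disjoint_family_on (\<lambda>i. {fst (I i)<..snd (I i)}) {..<K} \<Longrightarrow>
      indep_vars (\<lambda>_. ?S) (\<lambda>i. interval_count D (fst (I i)) (snd (I i))) {..<K}"
    for I :: "nat \<Rightarrow> real \<times> real" and K
    using pp unfolding nhpp_def by blast
  have "indep_vars (\<lambda>_. ?S) ?X {..<K}" for K
    using iv[of K "\<lambda>i. (h * real i, h * real (Suc i))"] le disj by simp
  hence ind: "indep_vars (\<lambda>_. count_space UNIV) (\<lambda>k \<omega>. ?X k \<omega> \<noteq> 0) {..<K}" for K
    by (rule indep_vars_compose2) simp
  have "prob {\<omega> \<in> space P. ?X k \<omega> \<noteq> 0} = 1 - exp (- (L * h))" if k: "N \<le> k" for k
  proof -
    have [measurable]: "?X k \<in> measurable P ?S"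
      and cnt: "prob {\<omega> \<in> space P. ?X k \<omega> = 0} = exp (- integral {h * real k..h * real (Suc k)} lam)"
      using pp le[of k] unfolding nhpp_def by (auto simp del: of_nat_Suc)
    have "integral {h * real k..h * real (Suc k)} lam
        = integral {h * real k..h * real (Suc k)} (\<lambda>_. L)"
    proof (rule Henstock_Kurzweil_Integration.integral_cong)
      fix t assume "t \<in> {h * real k..h * real (Suc k)}"
      moreover have "h * real N \<le> h * real k" using k h by simp
      ultimately show "lam t = L" using lam by auto
    qed
    also have "\<dots> = L * h" using le[of k] h by (simp add: algebra_simps)
    finally have "prob {\<omega> \<in> space P. ?X k \<omega> = 0} = exp (- (L * h))" using cnt by simp
    moreover have "{\<omega> \<in> space P. ?X k \<omega> = 0} \<in> events" by measurable
    moreover have "{\<omega> \<in> space P. ?X k \<omega> \<noteq> 0} = space P - {\<omega> \<in> space P. ?X k \<omega> = 0}" by auto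
    ultimately show ?thesis using prob_compl by metis
  qed
  with ind show ?thesis using L h by unfold_locales auto
qed

text \<open>Finiteness matters because \<open>card\<close> is 0 on infinite sets as well.\<close>

lemma occupied_iff_interval_count:
  assumes "finite (D \<omega> \<inter> {..h * real (Suc k)})"
  shows "occupied (D \<omega>) h k \<longleftrightarrow> interval_count D (h * real k) (h * real (Suc k)) \<omega> \<noteq> 0"
proof -
  have "finite (D \<omega> \<inter> {h * real k<..h * real (Suc k)})"
    by (rule finite_subset[OF _ assms]) auto
  thus ?thesis by (simp add: occupied_def interval_count_def)
qed

text \<open>Used in contrapositive form: a finite grid makespan means that the chain
  finishes.\<close>

lemma grid_makespan_infinite:
  assumes "\<And>k. fst (grid_state B ms k) \<noteq> []"
  shows "grid_makespan B ms = \<infinity>"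
proof (rule ccontr)
  assume "grid_makespan B ms \<noteq> \<infinity>"
  then obtain x where x: "0 \<le> x" "grid_makespan B ms = ennreal x"
    by (cases "grid_makespan B ms") auto
  have "of_nat n \<le> grid_makespan B ms" for n
  proof -
    have "of_nat n = (\<Sum>k<n. of_bool (fst (grid_state B ms k) \<noteq> []) :: ennreal)"
      using assms by simp
    also have "\<dots> \<le> grid_makespan B ms" unfolding grid_makespan_def by (rule sum_le_suminf) auto
    finally show ?thesis .
  qed
  hence "real n \<le> x" for n using x by (metis ennreal_le_iff ennreal_of_nat_eq_real_of_nat)
  moreover obtain n where "x < real n" using reals_Archimedean2 by blast
  ultimately show False by (metis not_le)
qed

section \<open>Rounding error and refinement of the grid\<close>

text \<open>Factor \<open>1 - q ^ 3\<close> as \<open>(1 - q) * (1 + q + q\<^sup>2)\<close>. The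
  bound has no \<open>1 - q\<close> in a denominator, so multiplying it by \<open>h\<close> gives an
  error that vanishes with \<open>h\<close>.\<close>

lemma power_diff3_le:
  fixes q :: real
  assumes "0 < q" "q < 1" "3 \<le> m"
  shows "((1 / q) ^ m - (1 / q) ^ (m - 3)) / (1 - q) \<le> 3 * (1 / q) ^ m"
proof -
  have "(1 / q) ^ m = (1 / q) ^ (m - 3) * (1 / q) ^ 3"
    using assms(3) by (simp flip: power_add)
  hence "(1 / q) ^ (m - 3) = (1 / q) ^ m * q ^ 3" using assms by (simp add: field_simps)
  hence "(1 / q) ^ m - (1 / q) ^ (m - 3) = (1 / q) ^ m * ((1 - q) * (1 + q + q\<^sup>2))"
    by (simp add: algebra_simps power2_eq_square power3_eq_cube)
  hence "((1 / q) ^ m - (1 / q) ^ (m - 3)) / (1 - q) = (1 / q) ^ m * (1 + q + q\<^sup>2)"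
    using assms by simp
  also have "\<dots> \<le> (1 / q) ^ m * 3"
    using assms power_le_one[of q 2] by (intro mult_left_mono) auto
  finally show ?thesis by simp
qed

text \<open>The order \<open>cs\<close> is bounded above by runs rounded up, the order
  \<open>ds\<close> below by runs rounded down. Both grid means are explicit and symmetric, so only
  the rounding separates them.\<close>

lemma expected_makespan_le_discretized:
  fixes D :: "'w \<Rightarrow> real set"
  assumes pp: "nhpp P lam D" and h: "h > 0" and N: "N > 0" and L: "L > 0"
    and lam: "\<And>t. h * real N \<le> t \<Longrightarrow> lam t = L"
    and perm: "mset cs = mset ds" and large: "\<forall>c\<in>set cs. h * real (N + 4) \<le> c"
  shows "expected_makespan P D cs 0 \<le> expected_makespan P D ds 0
           + ennreal (h * (1 + 3 * (\<Sum>c\<leftarrow>cs. exp (L * (c + h)))))"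
proof (cases "cs = []")
  case True
  thus ?thesis using perm by simp
next
  case False
  let ?B = "\<lambda>k \<omega>. interval_count D (h * real k) (h * real (Suc k)) \<omega> \<noteq> 0"
  define q where "q = exp (- (L * h))"
  interpret bernoulli_grid P ?B q N
    unfolding q_def by (rule nhpp_bernoulli_grid[OF pp h L lam])
  define u where "u c = nat \<lceil>c / h\<rceil>" for c
  \<comment> \<open>As \<open>u c \<le> c / h + 1\<close>, subtracting 3 leaves the two spare cells
    of the lower comparison; \<open>N + 4 \<le> u c\<close> still gives
    \<open>N < l c\<close>.\<close>
  define l where "l c = u c - 3" for c
  have fin: "finite (D \<omega> \<inter> {..b})" if "\<omega> \<in> space P" for \<omega> b
    using pp that unfolding nhpp_def by blast
  have occ: "(\<lambda>k. ?B k \<omega>) = occupied (D \<omega>) h" if "\<omega> \<in> space P" for \<omega>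
    using occupied_iff_interval_count[of D \<omega> h] fin[OF that] by blast
  have sets: "set cs = set ds" using perm by (rule mset_eq_setD)
  have ne: "ds \<noteq> []" using False perm by auto
  have c: "c > 0" "c \<le> h * real (u c)" "h * real (u c) \<le> c + h" "N + 4 \<le> u c"
    "h * real (l c + 2) \<le> c" if "c \<in> set cs" for c
  proof -
    have le: "h * real (N + 4) \<le> c" using large that by blast
    have "0 < h * real (N + 4)" using h by simp
    with le show c: "c > 0" by linarith
    hence "c / h > 0" using h by simp
    hence u: "c / h \<le> real (u c)" "real (u c) \<le> c / h + 1" unfolding u_def by linarith+
    show "c \<le> h * real (u c)" "h * real (u c) \<le> c + h"
      using u h by (auto simp: field_simps)
    have "real (N + 4) \<le> c / h" using le h by (simp add: field_simps)
    hence "real (N + 4) \<le> real (u c)" using u by linarith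
    thus N4: "N + 4 \<le> u c" by linarith
    hence "real (l c + 2) \<le> c / h" using u unfolding l_def by (simp add: of_nat_diff)
    thus "h * real (l c + 2) \<le> c" using h by (simp add: field_simps)
  qed
  have uN: "\<forall>m\<in>set (map u xs). N < m" and lN: "\<forall>m\<in>set (map l xs). N < m"
    if "set xs = set cs" for xs
    using c(4) that unfolding l_def by fastforce+
  define S where "S xs = real N + ((\<Sum>m\<leftarrow>xs. (1 / q) ^ m - 1) + 1
       - expectation (\<lambda>\<omega>. (1 / q) ^ snd (state [Suc N] N \<omega>))) / (1 - q)" for xs
  have "mset (map (\<lambda>c. (1 / q) ^ u c - 1) cs) = mset (map (\<lambda>c. (1 / q) ^ u c - 1) ds)"
    using perm by simp
  hence "(\<Sum>c\<leftarrow>cs. (1 / q) ^ u c - 1) = (\<Sum>c\<leftarrow>ds. (1 / q) ^ u c - 1)"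
    by (metis sum_mset_sum_list)
  hence S_perm: "S (map u cs) = S (map u ds)" by (simp add: S_def o_def)
  \<comment> \<open>The lower comparison needs \<open>finishes\<close>, which holds almost surely
    because the rounded-up grid makespan has finite mean.\<close>
  have "AE \<omega> in P. grid_makespan (\<lambda>k. ?B k \<omega>) (map u ds) \<noteq> \<infinity>"
    by (rule nn_integral_PInf_AE)
      (use nn_integral_grid_makespan[OF _ uN[OF sets[symmetric]]] ne in auto)
  hence AE_fin: "AE \<omega> in P. finishes (D \<omega>) ds 0"
  proof (rule AE_mp, intro AE_I2 impI)
    fix \<omega> assume \<omega>: "\<omega> \<in> space P" and "grid_makespan (\<lambda>k. ?B k \<omega>) (map u ds) \<noteq> \<infinity>"
    then obtain k where "fst (grid_state (occupied (D \<omega>) h) (map u ds) k) = []"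
      using grid_makespan_infinite occ by metis
    thus "finishes (D \<omega>) ds 0"
      by (intro seq_finish_le_grid(1)[OF fin[OF \<omega>] h, of ds u]) (use c sets in auto)
  qed
  have "expected_makespan P D cs 0
      \<le> (\<integral>\<^sup>+ \<omega>. ennreal h * grid_makespan (\<lambda>k. ?B k \<omega>) (map u cs) \<partial>P)"
    unfolding expected_makespan_def
  proof (rule nn_integral_mono)
    fix \<omega> assume \<omega>: "\<omega> \<in> space P"
    show "ennreal (seq_finish (D \<omega>) cs 0 - 0)
        \<le> ennreal h * grid_makespan (\<lambda>k. ?B k \<omega>) (map u cs)"
      using seq_finish_le_grid_makespan[OF fin[OF \<omega>] h, of cs u] c unfolding occ[OF \<omega>] by simp
  qed
  also have "\<dots> = ennreal (h * S (map u cs))"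
    using nn_integral_grid_makespan[OF _ uN[OF refl]] False h
    by (simp add: nn_integral_cmult ennreal_mult S_def)
  also have "h * S (map u cs) \<le> h * S (map l ds) + h * (3 * (\<Sum>c\<leftarrow>cs. exp (L * (c + h))))"
  proof -
    have "S (map u ds) - S (map l ds)
        = ((\<Sum>c\<leftarrow>ds. (1 / q) ^ u c - 1) - (\<Sum>c\<leftarrow>ds. (1 / q) ^ l c - 1)) / (1 - q)"
      by (simp add: S_def o_def diff_divide_distrib add_divide_distrib)
    also have "\<dots> = (\<Sum>c\<leftarrow>ds. ((1 / q) ^ u c - (1 / q) ^ l c) / (1 - q))"
      by (induction ds) (simp_all add: diff_divide_distrib add_divide_distrib)
    also have "\<dots> \<le> (\<Sum>c\<leftarrow>ds. 3 * exp (L * (c + h)))"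
    proof (rule sum_list_mono)
      fix x assume "x \<in> set ds"
      hence x: "x \<in> set cs" using sets by simp
      have "(1 / q) ^ u x = exp (L * (h * real (u x)))"
        by (simp add: q_def exp_minus inverse_eq_divide mult_ac flip: exp_of_nat_mult)
      also have "\<dots> \<le> exp (L * (x + h))" using c(3)[OF x] L by simp
      finally have pow: "(1 / q) ^ u x \<le> exp (L * (x + h))" .
      have "((1 / q) ^ u x - (1 / q) ^ l x) / (1 - q) \<le> 3 * (1 / q) ^ u x"
        unfolding l_def using c(4)[OF x] q_pos q_less_1 by (intro power_diff3_le) auto
      also have "\<dots> \<le> 3 * exp (L * (x + h))" using pow by simp
      finally show "((1 / q) ^ u x - (1 / q) ^ l x) / (1 - q) \<le> 3 * exp (L * (x + h))" by simp
    qed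
    also have "\<dots> = 3 * (\<Sum>c\<leftarrow>ds. exp (L * (c + h)))" by (rule sum_list_const_mult)
    also have "(\<Sum>c\<leftarrow>ds. exp (L * (c + h))) = (\<Sum>c\<leftarrow>cs. exp (L * (c + h)))"
      using perm by (metis mset_map sum_mset_sum_list)
    finally have "S (map u cs) \<le> S (map l ds) + 3 * (\<Sum>c\<leftarrow>cs. exp (L * (c + h)))"
      using S_perm by simp
    hence "h * S (map u cs) \<le> h * (S (map l ds) + 3 * (\<Sum>c\<leftarrow>cs. exp (L * (c + h))))"
      using h by (intro mult_left_mono) auto
    thus ?thesis by (simp add: distrib_left)
  qed
  finally have upper: "expected_makespan P D cs 0
      \<le> ennreal (h * S (map l ds) + h * (3 * (\<Sum>c\<leftarrow>cs. exp (L * (c + h)))))"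
    by (simp add: ennreal_leI)
  define G where "G = (\<lambda>\<omega>. grid_makespan (\<lambda>k. ?B k \<omega>) (map l ds))"
  have "map l ds \<noteq> []" using ne by simp
  note G = nn_integral_grid_makespan[OF this lN[OF sets[symmetric]], folded S_def G_def]
  have [measurable]: "G \<in> borel_measurable P" by (rule G(3))
  have int_G: "(\<integral>\<^sup>+ \<omega>. G \<omega> \<partial>P) = ennreal (S (map l ds))" using G(1) by (simp add: G_def)
  have "ennreal (h * S (map l ds)) = (\<integral>\<^sup>+ \<omega>. ennreal h * G \<omega> \<partial>P)"
    using int_G h G(2) by (simp add: nn_integral_cmult ennreal_mult)
  \<comment> \<open>Subtracting \<open>h\<close> on the measurable side avoids additivity for the
    finish time, whose measurability is not established. The inequality also holds where the
    subtraction truncates to 0.\<close>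
  also have "\<dots> \<le> (\<integral>\<^sup>+ \<omega>. (ennreal h * G \<omega> - ennreal h) + ennreal h \<partial>P)"
    by (intro nn_integral_mono) (simp add: ennreal_minus_le_iff[THEN iffD1] add.commute)
  also have "\<dots> = (\<integral>\<^sup>+ \<omega>. ennreal h * G \<omega> - ennreal h \<partial>P) + ennreal h"
    by (simp add: nn_integral_add emeasure_space_1)
  also have "(\<integral>\<^sup>+ \<omega>. ennreal h * G \<omega> - ennreal h \<partial>P) \<le> expected_makespan P D ds 0"
    unfolding expected_makespan_def
  proof (rule nn_integral_mono_AE, rule AE_mp[OF AE_fin], intro AE_I2 impI)
    fix \<omega> assume \<omega>: "\<omega> \<in> space P" and f: "finishes (D \<omega>) ds 0"
    have "ennreal h * G \<omega> \<le> ennreal (seq_finish (D \<omega>) ds 0) + ennreal h"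
      unfolding G_def occ[OF \<omega>]
      by (rule grid_makespan_le_seq_finish[OF fin[OF \<omega>] h _ f])
        (use c(5) lN[OF sets[symmetric]] sets in fastforce)
    thus "ennreal h * G \<omega> - ennreal h \<le> ennreal (seq_finish (D \<omega>) ds 0 - 0)"
      by (simp add: ennreal_minus_le_iff add.commute)
  qed
  finally have lower: "ennreal (h * S (map l ds)) \<le> expected_makespan P D ds 0 + ennreal h"
    by (simp add: add_right_mono)
  have nn: "0 \<le> (\<Sum>c\<leftarrow>cs. exp (L * (c + h)))" by (rule sum_list_nonneg) auto
  have "expected_makespan P D cs 0 \<le> ennreal (h * S (map l ds))
      + ennreal (h * (3 * (\<Sum>c\<leftarrow>cs. exp (L * (c + h)))))"
    using upper G(2) ne h nn by (simp add: ennreal_plus)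
  also have "\<dots> \<le> expected_makespan P D ds 0 + ennreal h
      + ennreal (h * (3 * (\<Sum>c\<leftarrow>cs. exp (L * (c + h)))))"
    by (rule add_right_mono[OF lower])
  also have "\<dots> = expected_makespan P D ds 0
      + ennreal (h * (1 + 3 * (\<Sum>c\<leftarrow>cs. exp (L * (c + h)))))"
    using h nn by (simp add: add.assoc distrib_left flip: ennreal_plus)
  finally show ?thesis .
qed

text \<open>One inequality suffices, since \<open>cs\<close> and \<open>ds\<close> can be
  exchanged.\<close>

lemma expected_makespan_le_of_mset_eq:
  fixes D :: "'w \<Rightarrow> real set"
  assumes pp: "nhpp P lam D" and t0: "t0 > 0" and L: "L > 0"
    and lam: "\<And>t. t0 \<le> t \<Longrightarrow> lam t = L"
    and perm: "mset cs = mset ds" and large: "\<forall>c\<in>set cs. t0 < c"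
  shows "expected_makespan P D cs 0 \<le> expected_makespan P D ds 0"
proof (rule ennreal_le_epsilon)
  fix e :: real assume e: "0 < e"
  \<comment> \<open>Taking \<open>t0\<close> in place of \<open>h\<close> makes \<open>K\<close>
    independent of the grid, as \<open>h \<le> t0\<close>.\<close>
  define K where "K = 1 + 3 * (\<Sum>c\<leftarrow>cs. exp (L * (c + t0)))"
  have "0 \<le> (\<Sum>c\<leftarrow>cs. exp (L * (c + t0)))" by (rule sum_list_nonneg) auto
  hence K: "K > 0" unfolding K_def by linarith
  \<comment> \<open>The least excess of a task over \<open>t0\<close>, capped at 1 so that
    \<open>Min\<close> has a nonempty argument.\<close>
  define \<delta> where "\<delta> = Min (insert 1 ((\<lambda>c. c - t0) ` set cs))"
  have \<delta>: "\<delta> > 0" unfolding \<delta>_def using large by simp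
  have \<delta>_le: "\<delta> \<le> c - t0" if "c \<in> set cs" for c unfolding \<delta>_def using that by simp
  \<comment> \<open>The first bound gives \<open>4 * h \<le> \<delta>\<close>, so each task spans
    \<open>N + 4\<close> cells; the second gives \<open>h * K \<le> e\<close>.\<close>
  define N where "N = Suc (nat \<lceil>max (4 * t0 / \<delta>) (t0 * K / e)\<rceil>)"
  define h where "h = t0 / real N"
  have N: "N > 0" "4 * t0 / \<delta> \<le> real N" "t0 * K / e \<le> real N" unfolding N_def by linarith+
  have h: "h > 0" "h * real N = t0" unfolding h_def using t0 N by auto
  have h\<delta>: "4 * h \<le> \<delta>" and hK: "h * K \<le> e"
    unfolding h_def using N e \<delta> by (auto simp: field_simps)
  have "h \<le> t0" unfolding h_def using t0 N(1) by (simp add: field_simps)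
  hence "(\<Sum>c\<leftarrow>cs. exp (L * (c + h))) \<le> (\<Sum>c\<leftarrow>cs. exp (L * (c + t0)))"
    using L by (intro sum_list_mono) simp
  hence "h * (1 + 3 * (\<Sum>c\<leftarrow>cs. exp (L * (c + h)))) \<le> h * K"
    unfolding K_def using h(1) by (intro mult_left_mono) auto
  with hK have bound: "h * (1 + 3 * (\<Sum>c\<leftarrow>cs. exp (L * (c + h)))) \<le> e" by linarith
  have "expected_makespan P D cs 0 \<le> expected_makespan P D ds 0
      + ennreal (h * (1 + 3 * (\<Sum>c\<leftarrow>cs. exp (L * (c + h)))))"
  proof (rule expected_makespan_le_discretized[OF pp h(1) N(1) L _ perm])
    show "\<forall>c\<in>set cs. h * real (N + 4) \<le> c"
    proof
      fix c assume "c \<in> set cs"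
      have "h * real (N + 4) = t0 + 4 * h" using h(2) by (simp add: algebra_simps)
      with h\<delta> \<delta>_le[OF \<open>c \<in> set cs\<close>] show "h * real (N + 4) \<le> c" by linarith
    qed
  qed (use lam h(2) in simp)
  also have "\<dots> \<le> expected_makespan P D ds 0 + ennreal e"
    by (intro add_left_mono ennreal_leI bound)
  finally show "expected_makespan P D cs 0 \<le> expected_makespan P D ds 0 + ennreal e" .
qed

theorem theorem3:
  fixes P :: "'w measure" and D :: "'w \<Rightarrow> real set"
    and n :: nat and a :: "nat \<Rightarrow> real"
    and lbar :: real and f :: "real \<Rightarrow> real" and lam :: "real \<Rightarrow> real"
    and t0 :: real and \<pi> :: "nat \<Rightarrow> nat"
  assumes a_pos: "\<forall>i\<in>{1..n}. a i > 0"
    and lbar_pos: "lbar > 0"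
    and f_pos: "\<forall>t\<ge>0. f t > 0"
    and f_diff: "\<forall>t\<ge>0. f differentiable (at t within {0..})"
    and f_inf: "(INF t\<in>{0..}. f t) > 0"
    and f_sup: "bdd_above (f ` {0..})"
    and lam_def: "\<forall>t. lam t = lbar * f t"
    and t0_pos: "t0 > 0"
    and lam_const: "\<forall>t>t0. lam t = lam t0"
    and a_large: "\<forall>i\<in>{1..n}. a i > t0"
    and pp: "nhpp P lam D"
    and perm: "\<pi> permutes {1..n}"
  shows "expected_makespan P D (map a [1..<n+1]) 0
       = expected_makespan P D (map (a \<circ> \<pi>) [1..<n+1]) 0"
proof -
  let ?cs = "map a [1..<n+1]" and ?ds = "map (a \<circ> \<pi>) [1..<n+1]"
  \<comment> \<open>The endpoint \<open>t0\<close> is included because cell integrals are over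
    closed intervals.\<close>
  have lam: "lam t = lam t0" if "t0 \<le> t" for t
    using lam_const that by (cases "t = t0") auto
  have "f t0 > 0" using f_pos t0_pos by simp
  hence L: "lam t0 > 0" using lam_def lbar_pos by simp
  have img: "\<pi> ` {1..<n+1} = {1..<n+1}"
    using permutes_image[OF perm] by (simp add: atLeastLessThanSuc_atLeastAtMost)
  have "inj_on \<pi> {1..<n+1}" using permutes_inj_on[OF perm] .
  hence "mset (map \<pi> [1..<n+1]) = mset [1..<n+1]"
    using img by (subst set_eq_iff_mset_eq_distinct[symmetric]) (auto simp: distinct_map simp del: upt_Suc)
  hence "mset (map a (map \<pi> [1..<n+1])) = mset (map a [1..<n+1])" by (metis mset_map)
  hence perm': "mset ?cs = mset ?ds" by (simp add: o_def)
  have large: "\<forall>c\<in>set ?cs. t0 < c" using a_large by auto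
  hence large': "\<forall>c\<in>set ?ds. t0 < c" unfolding mset_eq_setD[OF perm'] .
  note le = expected_makespan_le_of_mset_eq[OF pp t0_pos L lam]
  show ?thesis by (intro antisym le perm' perm'[symmetric] large large')
qed

end
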